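(* Let $R$ be a commutative ring with identity $1\neq 0$ and let $I$ be a non-zero ideal of $R$. If $R$ is not an integral domain, then $\mathrm{girth}(\overline{\Gamma}(R\Join I))=3$.
   Context: For a commutative ring $A$ with $1\neq 0$, $Z(A)$ is the set of zero-divisors of $A$ (including $0$) and $Z(A)^*=Z(A)\setminus\{0\}$. The extended zero-divisor graph $\overline{\Gamma}(A)$ is the simple graph with vertex set $Z(A)^*$ in which distinct vertices $x,y$ are adjacent if and only if there exist integers $n,m\geq 1$ with $x^ny^m=0$, $x^n\neq 0$ and $y^m\neq 0$. The girth of a graph $G$ is the length of a shortest cycle of $G$, and $\infty$ if $G$ has no cycle. For an ideal $I$ of $R$, the amalgamated duplication of $R$ along $I$ is the subring $R\Join I=\{(r,r+i) : r\in R,\ i\in I\}$ of $R\times R$. *)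

theory Defs
  imports
    "HOL-Algebra.Chinese_Remainder"
    "HOL-Algebra.Subrings"
    "HOL-Library.Extended_Nat"
    "Graph_Theory.Pair_Digraph"
begin

section \<open>Zero-divisors and the extended zero-divisor graph\<close>

definition zero_divisors :: "('a, 'm) ring_scheme \<Rightarrow> 'a set" where
  "zero_divisors A =
     {x \<in> carrier A. \<exists>y \<in> carrier A. y \<noteq> \<zero>\<^bsub>A\<^esub> \<and> x \<otimes>\<^bsub>A\<^esub> y = \<zero>\<^bsub>A\<^esub>}"

text \<open>Simple graphs are represented by digraphs with a symmetric, irreflexive arc relation; for the
  graph below this is lemma \<open>extended_zero_divisor_graph_simple\<close>.\<close>

definition extended_zero_divisor_graph :: "('a, 'm) ring_scheme \<Rightarrow> 'a pair_pre_digraph" where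
  "extended_zero_divisor_graph A =
     \<lparr>pverts = zero_divisors A - {\<zero>\<^bsub>A\<^esub>},
      parcs = {(x, y). x \<in> zero_divisors A - {\<zero>\<^bsub>A\<^esub>} \<and> y \<in> zero_divisors A - {\<zero>\<^bsub>A\<^esub>} \<and> x \<noteq> y \<and>
        (\<exists>(n::nat) (m::nat). n \<ge> 1 \<and> m \<ge> 1 \<and>
           x [^]\<^bsub>A\<^esub> n \<otimes>\<^bsub>A\<^esub> y [^]\<^bsub>A\<^esub> m = \<zero>\<^bsub>A\<^esub> \<and>
           x [^]\<^bsub>A\<^esub> n \<noteq> \<zero>\<^bsub>A\<^esub> \<and> y [^]\<^bsub>A\<^esub> m \<noteq> \<zero>\<^bsub>A\<^esub>)}\<rparr>"

lemma (in cring) zero_in_zero_divisors: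
  assumes "\<one> \<noteq> \<zero>"
  shows "\<zero> \<in> zero_divisors R"
  using assms unfolding zero_divisors_def by auto

lemma (in cring) extended_zero_divisor_graph_simple:
  "pair_bidirected_digraph (extended_zero_divisor_graph R)"
proof (unfold_locales, goal_cases)
  case 3
  have "(y, x) \<in> parcs (extended_zero_divisor_graph R)"
    if "(x, y) \<in> parcs (extended_zero_divisor_graph R)" for x y
  proof -
    have "x \<in> carrier R" "y \<in> carrier R"
      using that by (auto simp: extended_zero_divisor_graph_def zero_divisors_def)
    then have "x [^] n \<otimes> y [^] m = y [^] m \<otimes> x [^] n" for n m :: nat
      by (simp add: m_comm)
    then show ?thesis
      using that unfolding extended_zero_divisor_graph_def by auto
  qed
  then show ?case by (auto simp: symmetric_def intro!: symI)
qed (auto simp: extended_zero_divisor_graph_def)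

section \<open>Girth\<close>

text \<open>The library's cycles are directed, so an edge traversed back and forth is a cycle of length 2.
  In a symmetric irreflexive digraph, the cycles of the underlying simple graph are exactly the
  directed cycles of length at least 3. The infimum of the empty set in \<^typ>\<open>enat\<close> is \<open>\<infinity>\<close>.\<close>

definition girth :: "'a pair_pre_digraph \<Rightarrow> enat" where
  "girth G = (INF p \<in> {p. pre_digraph.cycle (with_proj G) p \<and> length p \<ge> 3}. enat (length p))"

section \<open>Amalgamated duplication of a ring along an ideal\<close>

definition duplication :: "('a, 'm) ring_scheme \<Rightarrow> 'a set \<Rightarrow> ('a \<times> 'a) ring" where
  "duplication R I =
     (RDirProd R R)\<lparr>carrier := {(r, r \<oplus>\<^bsub>R\<^esub> i) | r i. r \<in> carrier R \<and> i \<in> I}\<rparr>"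

lemma duplication_simps:
  "carrier (duplication R I) = {(r, r \<oplus>\<^bsub>R\<^esub> i) | r i. r \<in> carrier R \<and> i \<in> I}"
  "(a, b) \<otimes>\<^bsub>duplication R I\<^esub> (c, d) = (a \<otimes>\<^bsub>R\<^esub> c, b \<otimes>\<^bsub>R\<^esub> d)"
  "(a, b) \<oplus>\<^bsub>duplication R I\<^esub> (c, d) = (a \<oplus>\<^bsub>R\<^esub> c, b \<oplus>\<^bsub>R\<^esub> d)"
  "\<one>\<^bsub>duplication R I\<^esub> = (\<one>\<^bsub>R\<^esub>, \<one>\<^bsub>R\<^esub>)"
  "\<zero>\<^bsub>duplication R I\<^esub> = (\<zero>\<^bsub>R\<^esub>, \<zero>\<^bsub>R\<^esub>)"
  by (auto simp: duplication_def RDirProd_def DirProd_def monoid.defs)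

lemma duplication_subring:
  fixes R (structure)
  assumes "cring R" and "ideal I R"
  shows "subring (carrier (duplication R I)) (RDirProd R R)"
proof -
  interpret cring R by fact
  interpret I: ideal I R by fact
  interpret P: ring "RDirProd R R" by (rule RDirProd_ring) (rule ring_axioms)+
  have ops [simp]:
    "(a, b) \<otimes>\<^bsub>RDirProd R R\<^esub> (c, d) = (a \<otimes> c, b \<otimes> d)"
    "(a, b) \<oplus>\<^bsub>RDirProd R R\<^esub> (c, d) = (a \<oplus> c, b \<oplus> d)"
    "\<one>\<^bsub>RDirProd R R\<^esub> = (\<one>, \<one>)" "\<zero>\<^bsub>RDirProd R R\<^esub> = (\<zero>, \<zero>)" for a b c d
    by (auto simp: RDirProd_def DirProd_def monoid.defs)
  have neg: "\<ominus>\<^bsub>RDirProd R R\<^esub> (a, b) = (\<ominus> a, \<ominus> b)" if "a \<in> carrier R" "b \<in> carrier R" for a b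
    using that by (intro P.minus_equality) (auto simp: RDirProd_carrier l_neg)
  have mem: "(a, b) \<in> carrier (duplication R I)"
    if "a \<in> carrier R" "i \<in> I" "b = a \<oplus> i" for a b i
    using that by (auto simp: duplication_simps)
  show ?thesis
  proof (rule P.subringI)
    show "carrier (duplication R I) \<subseteq> carrier (RDirProd R R)"
      by (auto simp: duplication_simps RDirProd_carrier)
    show "\<one>\<^bsub>RDirProd R R\<^esub> \<in> carrier (duplication R I)"
      by (auto intro!: mem[of _ \<zero>])
  next
    fix x assume "x \<in> carrier (duplication R I)"
    then obtain r i where "x = (r, r \<oplus> i)" "r \<in> carrier R" "i \<in> I"
      by (auto simp: duplication_simps)
    then show "\<ominus>\<^bsub>RDirProd R R\<^esub> x \<in> carrier (duplication R I)"
      by (auto simp: neg minus_add intro!: mem[of _ "\<ominus> i"])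
  next
    fix x y assume "x \<in> carrier (duplication R I)" "y \<in> carrier (duplication R I)"
    then obtain r i s j where *: "x = (r, r \<oplus> i)" "r \<in> carrier R" "i \<in> I"
      "y = (s, s \<oplus> j)" "s \<in> carrier R" "j \<in> I"
      by (auto simp: duplication_simps)
    then have [simp]: "i \<in> carrier R" "j \<in> carrier R" by auto
    have "(r \<oplus> i) \<otimes> (s \<oplus> j) = r \<otimes> s \<oplus> (r \<otimes> j \<oplus> i \<otimes> (s \<oplus> j))"
      using * by (simp add: l_distr r_distr a_ac)
    moreover have "r \<otimes> j \<oplus> i \<otimes> (s \<oplus> j) \<in> I"
      using * by (intro I.a_closed I.I_l_closed I.I_r_closed) auto
    ultimately show "x \<otimes>\<^bsub>RDirProd R R\<^esub> y \<in> carrier (duplication R I)"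
      using * by (auto intro!: mem[of _ "r \<otimes> j \<oplus> i \<otimes> (s \<oplus> j)"])
    have "(r \<oplus> i) \<oplus> (s \<oplus> j) = (r \<oplus> s) \<oplus> (i \<oplus> j)"
      using * by (simp add: a_ac)
    then show "x \<oplus>\<^bsub>RDirProd R R\<^esub> y \<in> carrier (duplication R I)"
      using * by (auto intro!: mem[of _ "i \<oplus> j"])
  qed
qed

end

theory Submission
  imports Defs
begin

text \<open>If $R$ is not a domain, some $a \neq 0$ in $R$ annihilates some $i \neq 0$ in $I$:
  given $ab = 0$ with $a, b \neq 0$ and any $i \neq 0$ in $I$, either $ai = 0$, or $b$ annihilates
  $ai \in I$. Then $(a,a)$, $(i,0)$, $(0,i)$ is a triangle, already with exponents $n = m = 1$.\<close>

lemma (in cring) annihilated_ideal_element: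
  assumes "ideal I R" "I \<noteq> {\<zero>}" "\<one> \<noteq> \<zero>" "\<not> domain R"
  obtains a i where "a \<in> carrier R" "a \<noteq> \<zero>" "i \<in> I" "i \<noteq> \<zero>" "a \<otimes> i = \<zero>"
proof -
  interpret I: ideal I R by fact
  obtain i where i: "i \<in> I" "i \<noteq> \<zero>"
    using \<open>I \<noteq> {\<zero>}\<close> I.zero_closed by blast
  obtain a b where ab: "a \<in> carrier R" "b \<in> carrier R" "a \<otimes> b = \<zero>" "a \<noteq> \<zero>" "b \<noteq> \<zero>"
    using \<open>\<not> domain R\<close> \<open>\<one> \<noteq> \<zero>\<close> is_cring by (auto simp: domain_def domain_axioms_def)
  show ?thesis
  proof (cases "a \<otimes> i = \<zero>")
    case True
    with ab i that show ?thesis by blast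
  next
    case False
    have "b \<otimes> (a \<otimes> i) = \<zero>"
      using ab i by (simp add: m_assoc[symmetric] m_comm[of b a])
    with ab i False that[of b "a \<otimes> i"] show ?thesis by (simp add: I.I_l_closed)
  qed
qed

text \<open>One triangle is enough: \<open>girth\<close> takes its infimum only over cycles of
  length at least 3, so the lower bound holds by definition. As cycles are directed arc lists, one
  orientation of the triangle suffices.\<close>

lemma girth_eq_3I:
  assumes "pair_wf_digraph G"
    and "(x, y) \<in> parcs G" "(y, z) \<in> parcs G" "(z, x) \<in> parcs G"
    and "x \<noteq> y" "y \<noteq> z" "z \<noteq> x"
  shows "girth G = 3"
proof -
  interpret pair_wf_digraph G by fact
  have "pre_digraph.cycle (with_proj G) [(x, y), (y, z), (z, x)]"
    using assms by (auto simp: cycle_def awalk_def dest: in_arcsD1)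
  then have "girth G \<le> enat (length [(x, y), (y, z), (z, x)])"
    unfolding girth_def by (intro INF_lower) simp
  moreover have "3 \<le> girth G"
    unfolding girth_def by (intro INF_greatest) (simp add: numeral_eq_enat)
  ultimately show ?thesis
    by (simp add: numeral_eq_enat eval_nat_numeral)
qed

text \<open>With both products zero, each of \<open>x\<close> and \<open>y\<close> witnesses that
  the other is a zero-divisor, without appeal to commutativity. The monoid laws then give the
  exponents 1 through x^1 = x.\<close>

lemma extended_zero_divisor_graph_arcI:
  assumes "monoid A" "x \<in> carrier A" "y \<in> carrier A" "x \<noteq> \<zero>\<^bsub>A\<^esub>" "y \<noteq> \<zero>\<^bsub>A\<^esub>" "x \<noteq> y"
    and "x \<otimes>\<^bsub>A\<^esub> y = \<zero>\<^bsub>A\<^esub>" "y \<otimes>\<^bsub>A\<^esub> x = \<zero>\<^bsub>A\<^esub>"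
  shows "(x, y) \<in> parcs (extended_zero_divisor_graph A)"
proof -
  interpret monoid A by fact
  have "x [^]\<^bsub>A\<^esub> (1::nat) = x" "y [^]\<^bsub>A\<^esub> (1::nat) = y"
    using assms by (simp_all del: One_nat_def)
  then show ?thesis
    using assms unfolding extended_zero_divisor_graph_def zero_divisors_def
    by (auto intro!: exI[of _ "1::nat"])
qed

lemma duplication_monoid:
  assumes "cring R" "ideal I R"
  shows "monoid (duplication R I)"
proof -
  interpret cring R by fact
  interpret I: ideal I R by fact
  interpret P: ring "RDirProd R R" by (rule RDirProd_ring) (rule ring_axioms)+
  \<comment> \<open>\<open>duplication R I\<close> is \<open>RDirProd R R\<close> with its carrier
    cut down to a subring, so it inherits the ring laws and in particular those of a monoid.\<close>
  have "monoid ((RDirProd R R)\<lparr>carrier := carrier (duplication R I)\<rparr>)"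
    using P.subring_is_ring[OF duplication_subring[OF assms]] by (simp add: ring_def)
  then show ?thesis by (simp add: duplication_def)
qed

theorem theorem3p10:
  fixes R :: "('a, 'm) ring_scheme" and I :: "'a set"
  assumes "cring R" and "\<one>\<^bsub>R\<^esub> \<noteq> \<zero>\<^bsub>R\<^esub>"
    and "ideal I R" and "I \<noteq> {\<zero>\<^bsub>R\<^esub>}"
    and "\<not> domain R"
  shows "girth (extended_zero_divisor_graph (duplication R I)) = 3"
proof -
  interpret cring R by fact
  interpret I: ideal I R by fact
  obtain a i where ai: "a \<in> carrier R" "a \<noteq> \<zero>\<^bsub>R\<^esub>" "i \<in> I" "i \<noteq> \<zero>\<^bsub>R\<^esub>" "a \<otimes>\<^bsub>R\<^esub> i = \<zero>\<^bsub>R\<^esub>"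
    by (rule annihilated_ideal_element) (use assms in auto)
  then have [simp]: "i \<in> carrier R" "i \<otimes>\<^bsub>R\<^esub> a = \<zero>\<^bsub>R\<^esub>" by (auto simp: m_comm)
  let ?D = "duplication R I"
  \<comment> \<open>The elements of \<open>I\<close> that are added in the second coordinate are 0,
    -i and i: (a, a + 0), (i, i + (-i)), (0, 0 + i).\<close>
  have mem: "(a, a) \<in> carrier ?D" "(i, \<zero>\<^bsub>R\<^esub>) \<in> carrier ?D" "(\<zero>\<^bsub>R\<^esub>, i) \<in> carrier ?D"
    using ai I.a_inv_closed[of i]
    by (auto simp: duplication_simps r_neg intro: exI[of _ "\<zero>\<^bsub>R\<^esub>"] exI[of _ i] exI[of _ "\<ominus>\<^bsub>R\<^esub> i"])
  show ?thesis
  proof (rule girth_eq_3I)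
    show "pair_wf_digraph (extended_zero_divisor_graph ?D)"
      by unfold_locales (auto simp: extended_zero_divisor_graph_def)
    \<comment> \<open>All products vanish coordinatewise, since ai = ia = 0. Any two of the three
      vertices differ in a coordinate where exactly one of them is 0.\<close>
    show "((a, a), (i, \<zero>\<^bsub>R\<^esub>)) \<in> parcs (extended_zero_divisor_graph ?D)"
      "((i, \<zero>\<^bsub>R\<^esub>), (\<zero>\<^bsub>R\<^esub>, i)) \<in> parcs (extended_zero_divisor_graph ?D)"
      "((\<zero>\<^bsub>R\<^esub>, i), (a, a)) \<in> parcs (extended_zero_divisor_graph ?D)"
      using ai mem duplication_monoid[OF \<open>cring R\<close> \<open>ideal I R\<close>]
      by (auto intro!: extended_zero_divisor_graph_arcI simp: duplication_simps(2,5))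
  qed (use ai in auto)
qed

end
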